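(* Let $k\in\mathbb{N}$ (with $k\ge1$). For any two points $z_1,z_2\in\overline{B_1(0)}=\{z\in\mathbb{C}\mid|z|\le1\}$, $$\frac1{2\pi}\int_0^{2\pi}\int_0^1\big|Y_{\sqrt t,\theta}(z_1)-Y_{\sqrt t,\theta}(z_2)\big|\,dt\,d\theta\;\le\;2\,|z_1-z_2|\,\big(|z_1|+|z_2|\big).$$
   Context: Let $\xi=e^{2\pi i/k}$ and $B_r(0)=\{z\in\mathbb{C}\mid|z|<r\}$. For $\theta\in[0,2\pi)$ and $j=0,1,\dots,k-1$, let $$Q_j^\theta=\Big\{re^{i\alpha}\ \Big|\ r\in(0,1],\ \alpha\in\big[\theta+\tfrac{2\pi j}{k},\,\theta+\tfrac{2\pi(j+1)}{k}\big)\Big\};$$ these are $k$ disjoint sectors partitioning $\overline{B_1(0)}\setminus\{0\}$. For $t\in(0,1]$ define $Y_{t,\theta}:\overline{B_1(0)}\to\mathbb{C}$ by $Y_{t,\theta}(z)=\xi^j$ if $z\in Q_j^\theta\setminus B_t(0)$, and $Y_{t,\theta}(z)=0$ if $z\in B_t(0)$. *)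

theory Defs
  imports "HOL-Analysis.Analysis"
begin

definition xi :: "nat \<Rightarrow> complex" where
  "xi k = cis (2 * pi / real k)"

definition Q :: "nat \<Rightarrow> real \<Rightarrow> nat \<Rightarrow> complex set" where
  "Q k \<theta> j = {rcis r \<alpha> | r \<alpha>. r \<in> {0<..1} \<and>
      \<alpha> \<in> {\<theta> + 2 * pi * real j / real k ..< \<theta> + 2 * pi * real (j + 1) / real k}}"

text \<open>For \<open>k \<ge> 1\<close> the sectors \<open>Q k \<theta> j\<close>, \<open>j < k\<close>, partition the closed unit disc without
  the origin, so the description below is proper whenever \<open>0 < t\<close> and \<open>z \<in> cball 0 1\<close>.
  No value is intended outside this range of \<open>t\<close> and \<open>z\<close>.\<close>

definition Y :: "nat \<Rightarrow> real \<Rightarrow> real \<Rightarrow> complex \<Rightarrow> complex" where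
  "Y k t \<theta> z = (if z \<in> ball 0 t then 0 else xi k ^ (THE j. j < k \<and> z \<in> Q k \<theta> j))"

end

theory Submission
  imports Defs
begin

text \<open>Let \<open>a = |z1| \<le> b = |z2|\<close>. In the inner integral the integrand is \<open>0\<close> for \<open>t > b\<^sup>2\<close>, it is \<open>1\<close>
  on \<open>(a\<^sup>2, b\<^sup>2]\<close>, and for \<open>t \<le> a\<^sup>2\<close> it is the chord between two \<open>k\<close>-th roots of unity, which is
  at most \<open>2 * pi / k\<close> times the number of sector boundaries between the arguments. On average over \<open>\<theta>\<close>
  the number of boundaries between arguments that differ by \<open>\<delta>\<close> is exactly \<open>k * |\<delta>| / (2 * pi)\<close>, so
  the left-hand side is at most \<open>(b\<^sup>2 - a\<^sup>2) + a\<^sup>2 * |\<delta>|\<close>. Finally \<open>a * |\<delta>| \<le> 2 * |z1 - z2|\<close>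
  when \<open>|\<delta>| \<le> pi\<close>.\<close>

section \<open>Integrals of floor functions over whole periods\<close>

lemma has_integral_floor_period:
  fixes \<alpha> w :: real and n :: nat
  assumes "w > 0"
  shows "((\<lambda>u. real_of_int \<lfloor>(\<alpha> - u) / w\<rfloor>) has_integral \<alpha> - (real n + 1) * w)
           {real n * w..(real n + 1) * w}"
proof -
  define N where "N = \<lfloor>\<alpha> / w\<rfloor>"
  define f where "f = frac (\<alpha> / w)"
  \<comment> \<open>The floor is constant on each of the two open pieces that \<open>p\<close> cuts
    from the period: \<open>N - n\<close> to the left, \<open>N - n - 1\<close> to the right. The
    pieces have lengths \<open>f * w\<close> and \<open>(1 - f) * w\<close>, so with
    \<open>\<alpha> = (N + f) * w\<close> the two contributions recombine into an expression affine
    in \<alpha>, without any floor or fractional part.\<close>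
  define p where "p = (real n + f) * w"
  have f: "0 \<le> f" "f < 1" by (simp_all add: f_def frac_lt_1)
  have "\<alpha> / w = N + f" by (simp add: N_def f_def frac_def)
  then have \<alpha>: "\<alpha> = (N + f) * w" using assms by (simp add: field_simps)
  have p: "real n * w \<le> p" "p \<le> (real n + 1) * w"
    using f assms by (auto simp: p_def intro!: mult_right_mono)
  have *: "\<lfloor>(\<alpha> - u) / w\<rfloor> = N - int n" if "u \<in> box (real n * w) p" for u
  proof (rule floor_unique)
    show "real_of_int (N - int n) \<le> (\<alpha> - u) / w" "(\<alpha> - u) / w < real_of_int (N - int n) + 1"
      using that assms f mult_strict_right_mono[OF f(2) assms]
      by (auto simp: \<alpha> p_def field_simps)
  qed
  have **: "\<lfloor>(\<alpha> - u) / w\<rfloor> = N - int n - 1" if "u \<in> box p ((real n + 1) * w)" for u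
  proof (rule floor_unique)
    show "real_of_int (N - int n - 1) \<le> (\<alpha> - u) / w"
      "(\<alpha> - u) / w < real_of_int (N - int n - 1) + 1"
      using that assms mult_nonneg_nonneg[OF f(1) less_imp_le[OF assms]]
      by (auto simp: \<alpha> p_def field_simps)
  qed
  have const: "((\<lambda>_. c) has_integral (y - x) * c) (cbox x y)" if "x \<le> y" for c x y :: real
    using has_integral_const_real[of c x y] that by simp
  have "((\<lambda>u. real_of_int \<lfloor>(\<alpha> - u) / w\<rfloor>) has_integral
      (p - real n * w) * (real_of_int N - n)) (cbox (real n * w) p)"
    by (rule has_integral_spike_interior[OF const[OF p(1)]]) (use * in auto)
  moreover have "((\<lambda>u. real_of_int \<lfloor>(\<alpha> - u) / w\<rfloor>) has_integral
      ((real n + 1) * w - p) * (real_of_int N - n - 1)) (cbox p ((real n + 1) * w))"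
    by (rule has_integral_spike_interior[OF const[OF p(2)]]) (use ** in auto)
  ultimately have "((\<lambda>u. real_of_int \<lfloor>(\<alpha> - u) / w\<rfloor>) has_integral
      (p - real n * w) * (real_of_int N - n) + ((real n + 1) * w - p) * (real_of_int N - n - 1))
      {real n * w..(real n + 1) * w}"
    using has_integral_combine[OF p] by simp
  moreover have "(p - real n * w) * (real_of_int N - n)
      + ((real n + 1) * w - p) * (real_of_int N - n - 1) = \<alpha> - (real n + 1) * w"
    by (simp add: \<alpha> p_def algebra_simps)
  ultimately show ?thesis by simp
qed

lemma has_integral_floor:
  fixes \<alpha> w :: real and n :: nat
  assumes "w > 0"
  shows "((\<lambda>u. real_of_int \<lfloor>(\<alpha> - u) / w\<rfloor>) has_integral (\<Sum>i<n. \<alpha> - (real i + 1) * w))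
           {0..real n * w}"
proof (induction n)
  case 0
  then show ?case by (simp add: has_integral_refl)
next
  case (Suc n)
  show ?case
    using has_integral_combine[OF _ _ Suc has_integral_floor_period[OF assms, of \<alpha> n]] assms
    by (simp add: algebra_simps)
qed

text \<open>The floor is monotone, so once \<alpha> and \<beta> are ordered the absolute value
  disappears and the two integrals subtract. The terms \<open>(real i + 1) * w\<close> cancel, and
  every period contributes the same \<alpha> - \<beta>. For \<open>w = 2 * pi / k\<close> and
  \<open>n = k\<close> this is the exact average count of sector boundaries.\<close>

lemma has_integral_floor_diff:
  fixes \<alpha> \<beta> w :: real and n :: nat
  assumes "w > 0"
  shows "((\<lambda>u. \<bar>real_of_int \<lfloor>(\<alpha> - u) / w\<rfloor> - real_of_int \<lfloor>(\<beta> - u) / w\<rfloor>\<bar>) has_integral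
           real n * \<bar>\<alpha> - \<beta>\<bar>) {0..real n * w}"
proof -
  have *: "((\<lambda>u. \<bar>real_of_int \<lfloor>(\<alpha> - u) / w\<rfloor> - real_of_int \<lfloor>(\<beta> - u) / w\<rfloor>\<bar>) has_integral
           real n * \<bar>\<alpha> - \<beta>\<bar>) {0..real n * w}" if "\<beta> \<le> \<alpha>" for \<alpha> \<beta>
  proof -
    have "\<lfloor>(\<beta> - u) / w\<rfloor> \<le> \<lfloor>(\<alpha> - u) / w\<rfloor>" for u
      using that assms by (intro floor_mono divide_right_mono) auto
    then have "\<bar>real_of_int \<lfloor>(\<alpha> - u) / w\<rfloor> - real_of_int \<lfloor>(\<beta> - u) / w\<rfloor>\<bar>
        = real_of_int \<lfloor>(\<alpha> - u) / w\<rfloor> - real_of_int \<lfloor>(\<beta> - u) / w\<rfloor>" for u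
      by simp
    moreover have "(\<Sum>i<n. \<alpha> - (real i + 1) * w) - (\<Sum>i<n. \<beta> - (real i + 1) * w)
        = real n * \<bar>\<alpha> - \<beta>\<bar>"
      using that by (simp flip: sum_subtractf)
    ultimately show ?thesis
      using has_integral_diff[OF has_integral_floor[OF assms, of \<alpha> n]
          has_integral_floor[OF assms, of \<beta> n]] by simp
  qed
  show ?thesis
  proof (cases "\<beta> \<le> \<alpha>")
    case False
    then show ?thesis using *[of \<alpha> \<beta>] by (simp add: abs_minus_commute)
  qed (rule *)
qed

text \<open>Passage from the gauge integral to the Lebesgue integral, on the open interval to which
  \<open>interval_integral_Ioo\<close> will reduce the outer integral.\<close>

lemma
  fixes \<alpha> \<beta> w :: real and n :: nat
  assumes "w > 0"
  defines "g \<equiv> \<lambda>u. \<bar>real_of_int \<lfloor>(\<alpha> - u) / w\<rfloor> - real_of_int \<lfloor>(\<beta> - u) / w\<rfloor>\<bar>"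
  shows set_integrable_floor_diff: "set_integrable lborel {0<..<real n * w} g"
    and set_integral_floor_diff: "(LBINT u:{0<..<real n * w}. g u) = real n * \<bar>\<alpha> - \<beta>\<bar>"
proof -
  \<comment> \<open>Two floors differ by less than their arguments do, plus one. This bound is
    uniform in \<open>u\<close>, which gives integrability on the bounded interval.\<close>
  have "g u \<le> \<bar>\<alpha> - \<beta>\<bar> / w + 1" for u
  proof -
    have "(\<alpha> - u) / w - (\<beta> - u) / w = (\<alpha> - \<beta>) / w" by (simp add: diff_divide_distrib)
    moreover have "\<bar>(\<alpha> - \<beta>) / w\<bar> = \<bar>\<alpha> - \<beta>\<bar> / w" using assms(1) by simp
    ultimately show ?thesis unfolding g_def by linarith
  qed
  then have "AE u in lborel. u \<in> {0<..<real n * w} \<longrightarrow> norm (g u) \<le> \<bar>\<alpha> - \<beta>\<bar> / w + 1"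
    by (simp add: g_def)
  then show *: "set_integrable lborel {0<..<real n * w} g"
    unfolding set_integrable_def
    by (intro integrableI_bounded_set_indicator[where B = "\<bar>\<alpha> - \<beta>\<bar> / w + 1"])
       (use assms(1) in \<open>auto simp: g_def\<close>)
  have "(g has_integral real n * \<bar>\<alpha> - \<beta>\<bar>) {0<..<real n * w}"
    using has_integral_floor_diff[OF assms(1), of \<alpha> \<beta> n] assms(1)
    by (simp add: g_def has_integral_Icc_iff_Ioo)
  then show "(LBINT u:{0<..<real n * w}. g u) = real n * \<bar>\<alpha> - \<beta>\<bar>"
    using set_borel_integral_eq_integral(2)[OF *] by (simp add: integral_unique)
qed

section \<open>Chords of the unit circle and sector indices\<close>

lemma norm_cis_diff: "cmod (cis x - cis y) = 2 * \<bar>sin ((x - y) / 2)\<bar>"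
proof -
  have "cis x - cis y = cis y * (cis (x - y) - 1)"
    by (simp add: algebra_simps cis_mult)
  then show ?thesis
    using dist_exp_i_1[of "x - y"] by (simp add: norm_mult cis_conv_exp)
qed

lemma norm_cis_diff_le: "cmod (cis x - cis y) \<le> \<bar>x - y\<bar>"
  using abs_sin_x_le_abs_x[of "(x - y) / 2"] by (simp add: norm_cis_diff)

text \<open>A nonzero point fixes its angle only up to whole turns, and a turn by 2 * pi * n moves
  the floor by n * k. Membership in a sector therefore depends on the floor modulo k.\<close>

lemma mem_Q_iff:
  assumes "k \<ge> 1" "0 < r" "r \<le> 1"
  shows "rcis r \<alpha> \<in> Q k \<theta> j \<longleftrightarrow> (\<exists>n. int j = \<lfloor>(\<alpha> - \<theta>) / (2 * pi / k)\<rfloor> + n * int k)"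
proof -
  let ?w = "2 * pi / k"
  have k: "real k > 0" using assms by simp
  have w: "?w > 0" "?w * k = 2 * pi" using k by auto
  have eq: "rcis r \<alpha> = rcis s \<beta> \<longleftrightarrow> s = r \<and> (\<exists>n::int. \<beta> = \<alpha> + 2 * pi * n)" if "0 < s" for s \<beta>
  proof -
    have "s = r" if "rcis r \<alpha> = rcis s \<beta>"
      using arg_cong[OF that, of cmod] assms \<open>0 < s\<close> by simp
    then show ?thesis
      using assms sin_cos_eq_iff[of \<beta> \<alpha>] by (auto simp: rcis_def complex_eq_iff)
  qed
  have mem: "\<beta> \<in> {\<theta> + 2 * pi * real j / real k ..< \<theta> + 2 * pi * real (j + 1) / real k}
      \<longleftrightarrow> \<lfloor>(\<beta> - \<theta>) / ?w\<rfloor> = int j" for \<beta>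
    using k by (simp add: floor_eq_iff field_simps)
  have shift: "\<lfloor>(\<alpha> + 2 * pi * n - \<theta>) / ?w\<rfloor> = \<lfloor>(\<alpha> - \<theta>) / ?w\<rfloor> + n * int k" for n :: int
  proof -
    have "(\<alpha> + 2 * pi * n - \<theta>) / ?w = (\<alpha> - \<theta>) / ?w + of_int (n * int k)"
      using k by (simp add: field_simps)
    then show ?thesis by (metis floor_add_int)
  qed
  have "rcis r \<alpha> \<in> Q k \<theta> j \<longleftrightarrow> (\<exists>s \<beta>. rcis r \<alpha> = rcis s \<beta> \<and> s \<in> {0<..1} \<and> \<lfloor>(\<beta> - \<theta>) / ?w\<rfloor> = int j)"
    unfolding Q_def mem by blast
  also have "\<dots> \<longleftrightarrow> (\<exists>n::int. \<lfloor>(\<alpha> + 2 * pi * n - \<theta>) / ?w\<rfloor> = int j)"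
    (is "?L \<longleftrightarrow> ?R")
  proof
    show "?L \<Longrightarrow> ?R" using eq by (metis greaterThanAtMost_iff)
    show "?L" if "?R"
    proof -
      from that obtain n :: int where n: "\<lfloor>(\<alpha> + 2 * pi * n - \<theta>) / ?w\<rfloor> = int j" by blast
      have "rcis r \<alpha> = rcis r (\<alpha> + 2 * pi * n)" using eq assms(2) by blast
      with n assms show ?thesis by (intro exI[of _ r] exI[of _ "\<alpha> + 2 * pi * n"]) simp
    qed
  qed
  finally show ?thesis unfolding shift by (simp add: eq_commute)
qed

text \<open>The sector index is the floor reduced modulo k, and the reduction is invisible to powers
  of a k-th root of unity. The value of \<open>Y\<close> can thus be expressed through the unreduced
  floor, whose differences were integrated above.\<close>

lemma xi_power_sector:
  assumes "k \<ge> 1" "0 < r" "r \<le> 1"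
  shows "xi k ^ (THE j. j < k \<and> rcis r \<alpha> \<in> Q k \<theta> j)
    = cis (2 * pi / k * \<lfloor>(\<alpha> - \<theta>) / (2 * pi / k)\<rfloor>)"
proof -
  define m where "m = \<lfloor>(\<alpha> - \<theta>) / (2 * pi / k)\<rfloor>"
  have k: "int k > 0" using assms by simp
  have "(THE j. j < k \<and> rcis r \<alpha> \<in> Q k \<theta> j) = nat (m mod int k)"
  proof (rule the_equality)
    have "int (nat (m mod int k)) = m + (- (m div int k)) * int k"
      using k by (simp add: minus_div_mult_eq_mod)
    then show "nat (m mod int k) < k \<and> rcis r \<alpha> \<in> Q k \<theta> (nat (m mod int k))"
      unfolding mem_Q_iff[OF assms] m_def[symmetric] using k
      by (metis nat_less_iff pos_mod_bound pos_mod_sign)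
  next
    fix j assume j: "j < k \<and> rcis r \<alpha> \<in> Q k \<theta> j"
    then obtain n where "int j = m + n * int k"
      unfolding mem_Q_iff[OF assms] m_def[symmetric] by blast
    then have "m mod int k = int j mod int k" by simp
    with j show "j = nat (m mod int k)" by simp
  qed
  then have "xi k ^ (THE j. j < k \<and> rcis r \<alpha> \<in> Q k \<theta> j) = cis (2 * pi / k * of_int (m mod int k))"
    using k by (simp add: xi_def Complex.DeMoivre mult.commute[of "real_of_int _"])
  \<comment> \<open>The discarded quotient \<open>m div int k\<close> contributes only whole
    turns.\<close>
  also have "2 * pi / k * of_int (m mod int k) = 2 * pi / k * m + 2 * pi * of_int (- (m div int k))"
    using k by (simp add: minus_div_mult_eq_mod [symmetric] field_simps)
  also have "cis \<dots> = cis (2 * pi / k * m)"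
    by (simp only: cis_mult[symmetric] cis_multiple_2pi Ints_of_int mult_1_right)
  finally show ?thesis unfolding m_def .
qed

section \<open>The inner integral over t\<close>

lemma inner_integral_le:
  fixes z1 z2 :: complex and D :: real
  assumes le: "cmod z1 \<le> cmod z2" and "0 \<le> D"
    and D: "z1 \<noteq> 0 \<Longrightarrow> cmod (xi k ^ (THE j. j < k \<and> z1 \<in> Q k \<theta> j)
              - xi k ^ (THE j. j < k \<and> z2 \<in> Q k \<theta> j)) \<le> D"
  shows "(LBINT t=0..1. cmod (Y k (sqrt t) \<theta> z1 - Y k (sqrt t) \<theta> z2))
    \<le> (cmod z1)\<^sup>2 * D + ((cmod z2)\<^sup>2 - (cmod z1)\<^sup>2)"
proof -
  let ?a = "cmod z1" and ?b = "cmod z2"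
  let ?f = "\<lambda>t. cmod (Y k (sqrt t) \<theta> z1 - Y k (sqrt t) \<theta> z2)"
  \<comment> \<open>The two closed intervals share the point \<open>?a\<^sup>2\<close>. An upper
    bound tolerates this, the overlap has measure zero, and no endpoint needs separate care.\<close>
  let ?g = "\<lambda>t. D * indicator {0..?a\<^sup>2} t + indicator {?a\<^sup>2..?b\<^sup>2} t :: real"
  have ab: "?a\<^sup>2 \<le> ?b\<^sup>2" using le by simp
  have xi: "cmod (xi k ^ n) = 1" for n by (simp add: xi_def norm_power)
  have bound: "?f t \<le> ?g t" if "0 < t" for t
  proof -
    consider "?b < sqrt t" | "?a < sqrt t" "sqrt t \<le> ?b" | "sqrt t \<le> ?a" by linarith
    then show ?thesis
    proof cases
      case 1
      then show ?thesis using le \<open>0 \<le> D\<close> by (simp add: Y_def)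
    next
      case 2
      then have "t \<in> {?a\<^sup>2..?b\<^sup>2}"
        using that by (auto intro: sqrt_le_D simp: real_less_rsqrt real_le_lsqrt)
          (metis less_eq_real_def norm_ge_zero real_sqrt_le_iff real_sqrt_unique)
      with 2 show ?thesis using \<open>0 \<le> D\<close> by (simp add: Y_def xi)
    next
      case 3
      \<comment> \<open>Here \<open>sqrt t\<close> is positive, so \<open>z1\<close> is not the
        origin and the chord bound \<open>D\<close> applies; the origin lies in no sector, so its
        index would be unspecified.\<close>
      then have "t \<in> {0..?a\<^sup>2}" "z1 \<noteq> 0" using that by (auto intro: sqrt_le_D)
      with 3 show ?thesis using D le by (simp add: Y_def add_increasing2)
    qed
  qed
  have int: "integrable lborel ?g"
    by (intro Bochner_Integration.integrable_add integrable_mult_right integrable_real_indicator)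
      (auto simp: ab)
  have "(LBINT t=0..1. ?f t) = (LBINT t:{0<..<1}. ?f t)"
    using interval_integral_Ioo[of 0 1 ?f] by simp
  \<comment> \<open>\<open>integral_mono'\<close> asks for integrability of the nonnegative majorant
    only: a nonintegrable left side would have integral 0 by convention. Measurability of
    \<open>Y\<close> never has to be shown.\<close>
  also have "\<dots> \<le> integral\<^sup>L lborel ?g"
    unfolding set_lebesgue_integral_def
    using int
  proof (rule integral_mono')
    show "indicat_real {0<..<1} t *\<^sub>R ?f t \<le> ?g t" for t
      using bound[of t] \<open>0 \<le> D\<close> by (cases "t \<in> {0<..<1}") simp_all
  qed (use \<open>0 \<le> D\<close> in simp)
  also have "\<dots> = ?a\<^sup>2 * D + (?b\<^sup>2 - ?a\<^sup>2)"
    using ab by simp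
  finally show ?thesis .
qed

section \<open>Angle against distance\<close>

lemma sin_ge_half:
  assumes "0 \<le> x" "x \<le> pi / 2"
  shows "x / 2 \<le> sin x"
proof -
  \<comment> \<open>The cubic Taylor error x^3 / 6 is at most x / 2 as soon as x^2 is at most 3; 1.6
    lies above pi / 2 and its square below 3.\<close>
  have "x \<le> 1.6" using assms pi_less_4 pi_approx by simp
  then have "x\<^sup>2 \<le> 1.6\<^sup>2" using assms(1) by (intro power_mono)
  then have "x * x\<^sup>2 \<le> x * 3" using assms(1) by (intro mult_left_mono) (auto simp: power2_eq_square)
  moreover have "\<bar>sin x - x\<bar> \<le> x * x\<^sup>2 / 6"
    using Maclaurin_sin_bound[of x 3] assms(1)
    by (simp add: numeral_eq_Suc sin_coeff_def fact_numeral field_simps)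
  ultimately show ?thesis by linarith
qed

lemma norm_mult_angle_le:
  assumes "0 \<le> a" "a \<le> b" "\<bar>\<delta>\<bar> \<le> pi"
  shows "a * \<bar>\<delta>\<bar> \<le> 2 * cmod (rcis a \<alpha> - rcis b (\<alpha> + \<delta>))"
proof -
  have law_of_cosines: "(cmod (rcis a \<alpha> - rcis b (\<alpha> + \<delta>)))\<^sup>2
      = a\<^sup>2 + b\<^sup>2 - 2 * a * b * (cos \<alpha> * cos (\<alpha> + \<delta>) + sin \<alpha> * sin (\<alpha> + \<delta>))" for a b
  proof -
    have "(a * cos \<alpha> - b * cos (\<alpha> + \<delta>))\<^sup>2 + (a * sin \<alpha> - b * sin (\<alpha> + \<delta>))\<^sup>2
      = a\<^sup>2 * ((sin \<alpha>)\<^sup>2 + (cos \<alpha>)\<^sup>2) + b\<^sup>2 * ((sin (\<alpha> + \<delta>))\<^sup>2 + (cos (\<alpha> + \<delta>))\<^sup>2)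
        - 2 * a * b * (cos \<alpha> * cos (\<alpha> + \<delta>) + sin \<alpha> * sin (\<alpha> + \<delta>))"
      by algebra
    then show ?thesis by (simp add: cmod_power2)
  qed
  have unit: "(cmod (cis \<alpha> - cis (\<alpha> + \<delta>)))\<^sup>2
      = 2 - 2 * (cos \<alpha> * cos (\<alpha> + \<delta>) + sin \<alpha> * sin (\<alpha> + \<delta>))"
    using law_of_cosines[of 1 1] by (simp add: rcis_def)
  have eq: "(cmod (rcis a \<alpha> - rcis b (\<alpha> + \<delta>)))\<^sup>2
      = (a - b)\<^sup>2 + a * b * (cmod (cis \<alpha> - cis (\<alpha> + \<delta>)))\<^sup>2"
    unfolding law_of_cosines unit by (simp add: power2_eq_square algebra_simps)
  have "a * a * (cmod (cis \<alpha> - cis (\<alpha> + \<delta>)))\<^sup>2 \<le> a * b * (cmod (cis \<alpha> - cis (\<alpha> + \<delta>)))\<^sup>2"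
    using assms by (intro mult_right_mono mult_left_mono) auto
  then have "(a * cmod (cis \<alpha> - cis (\<alpha> + \<delta>)))\<^sup>2 \<le> (cmod (rcis a \<alpha> - rcis b (\<alpha> + \<delta>)))\<^sup>2"
    unfolding eq by (simp add: power_mult_distrib power2_eq_square[of a] add_increasing)
  then have "a * cmod (cis \<alpha> - cis (\<alpha> + \<delta>)) \<le> cmod (rcis a \<alpha> - rcis b (\<alpha> + \<delta>))"
    by (rule power2_le_imp_le) simp
  moreover have "\<bar>\<delta>\<bar> \<le> 2 * cmod (cis \<alpha> - cis (\<alpha> + \<delta>))"
  proof -
    have "\<bar>\<delta>\<bar> / 4 \<le> \<bar>sin (\<bar>\<delta>\<bar> / 2)\<bar>" using sin_ge_half[of "\<bar>\<delta>\<bar> / 2"] assms(3) by simp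
    also have "\<dots> = \<bar>sin (\<delta> / 2)\<bar>" by (cases "\<delta> \<ge> 0") auto
    finally show ?thesis by (simp add: norm_cis_diff)
  qed
  then have "a * \<bar>\<delta>\<bar> \<le> a * (2 * cmod (cis \<alpha> - cis (\<alpha> + \<delta>)))"
    using assms(1) by (rule mult_left_mono)
  ultimately show ?thesis by simp
qed

lemma outer_integral_le:
  fixes k :: nat
  assumes "k \<ge> 1" "0 \<le> a" "a \<le> b" "b \<le> 1"
  shows "(LBINT \<theta>=0..ereal (2 * pi). (LBINT t=0..1.
      cmod (Y k (sqrt t) \<theta> (rcis a \<alpha>) - Y k (sqrt t) \<theta> (rcis b \<beta>))))
    \<le> 2 * pi * (a\<^sup>2 * \<bar>\<alpha> - \<beta>\<bar> + (b\<^sup>2 - a\<^sup>2))"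
proof -
  define w where "w = 2 * pi / k"
  have w: "w > 0" "real k * w = 2 * pi" using assms by (auto simp: w_def)
  define g where "g = (\<lambda>\<theta>. \<bar>real_of_int \<lfloor>(\<alpha> - \<theta>) / w\<rfloor> - real_of_int \<lfloor>(\<beta> - \<theta>) / w\<rfloor>\<bar>)"
  let ?f = "\<lambda>\<theta>. LBINT t=0..1. cmod (Y k (sqrt t) \<theta> (rcis a \<alpha>) - Y k (sqrt t) \<theta> (rcis b \<beta>))"
  let ?G = "\<lambda>\<theta>. a\<^sup>2 * (w * g \<theta>) + (b\<^sup>2 - a\<^sup>2)"
  have ab: "a\<^sup>2 \<le> b\<^sup>2" using assms by simp
  have G0: "0 \<le> ?G \<theta>" for \<theta> using w ab by (simp add: g_def)
  have fG: "?f \<theta> \<le> ?G \<theta>" for \<theta>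
  proof -
    have "cmod (xi k ^ (THE j. j < k \<and> rcis a \<alpha> \<in> Q k \<theta> j)
              - xi k ^ (THE j. j < k \<and> rcis b \<beta> \<in> Q k \<theta> j)) \<le> w * g \<theta>" if "rcis a \<alpha> \<noteq> 0"
    proof -
      have "0 < a" using that assms by auto
      then have "cmod (xi k ^ (THE j. j < k \<and> rcis a \<alpha> \<in> Q k \<theta> j)
              - xi k ^ (THE j. j < k \<and> rcis b \<beta> \<in> Q k \<theta> j))
          = cmod (cis (w * \<lfloor>(\<alpha> - \<theta>) / w\<rfloor>) - cis (w * \<lfloor>(\<beta> - \<theta>) / w\<rfloor>))"
        using assms by (simp add: xi_power_sector w_def)
      also have "\<dots> \<le> \<bar>w * \<lfloor>(\<alpha> - \<theta>) / w\<rfloor> - w * \<lfloor>(\<beta> - \<theta>) / w\<rfloor>\<bar>"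
        by (rule norm_cis_diff_le)
      also have "\<dots> = w * g \<theta>"
        using w by (simp add: g_def abs_mult flip: right_diff_distrib)
      finally show ?thesis .
    qed
    moreover have "0 \<le> w * g \<theta>" using w by (simp add: g_def)
    ultimately show ?thesis
      using inner_integral_le[of "rcis a \<alpha>" "rcis b \<beta>" "w * g \<theta>" k \<theta>] assms by simp
  qed
  have g: "set_integrable lborel {0<..<2 * pi} g"
    "(LBINT \<theta>:{0<..<2 * pi}. g \<theta>) = real k * \<bar>\<alpha> - \<beta>\<bar>"
    using set_integrable_floor_diff[OF w(1), of k \<alpha> \<beta>] set_integral_floor_diff[OF w(1), of k \<alpha> \<beta>]
    by (simp_all add: w(2) g_def)
  have c: "set_integrable lborel {0<..<2 * pi} (\<lambda>_. b\<^sup>2 - a\<^sup>2)"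
    by (simp add: set_integrable_def)
  have G: "set_integrable lborel {0<..<2 * pi} ?G"
    using g(1) c by (intro set_integral_add set_integrable_mult_right) auto
  have "(LBINT \<theta>=0..ereal (2 * pi). ?f \<theta>) = (LBINT \<theta>:{0<..<2 * pi}. ?f \<theta>)"
    using interval_integral_Ioo[of 0 "ereal (2 * pi)" ?f] by simp
  also have "\<dots> \<le> (LBINT \<theta>:{0<..<2 * pi}. ?G \<theta>)"
    unfolding set_lebesgue_integral_def
    using G[unfolded set_integrable_def]
    by (rule integral_mono') (use fG G0 in \<open>auto intro: mult_left_mono simp: indicator_def\<close>)
  also have "\<dots> = a\<^sup>2 * (w * (real k * \<bar>\<alpha> - \<beta>\<bar>)) + 2 * pi * (b\<^sup>2 - a\<^sup>2)"
  proof -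
    have "(LBINT \<theta>:{0<..<2 * pi}. ?G \<theta>)
        = (LBINT \<theta>:{0<..<2 * pi}. a\<^sup>2 * (w * g \<theta>)) + (LBINT \<theta>:{0<..<2 * pi}. b\<^sup>2 - a\<^sup>2)"
      using g(1) c by (intro set_integral_add set_integrable_mult_right) auto
    moreover have "(LBINT \<theta>:{0<..<2 * pi}. b\<^sup>2 - a\<^sup>2) = 2 * pi * (b\<^sup>2 - a\<^sup>2)"
      by (simp add: set_lebesgue_integral_def)
    ultimately show ?thesis using g(2) by simp
  qed
  also have "w * (real k * \<bar>\<alpha> - \<beta>\<bar>) = real k * w * \<bar>\<alpha> - \<beta>\<bar>"
    by (simp add: ac_simps)
  also note w(2)
  finally show ?thesis by (simp add: algebra_simps)
qed

lemma lemma4p2_ordered: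
  fixes k :: nat and z1 z2 :: complex
  assumes "k \<ge> 1" and le: "cmod z1 \<le> cmod z2" "cmod z2 \<le> 1"
  shows "1 / (2 * pi) *
      (LBINT \<theta>=0..ereal (2 * pi). (LBINT t=0..1. cmod (Y k (sqrt t) \<theta> z1 - Y k (sqrt t) \<theta> z2)))
    \<le> 2 * cmod (z1 - z2) * (cmod z1 + cmod z2)"
proof -
  let ?a = "cmod z1" and ?b = "cmod z2" and ?d = "cmod (z1 - z2)"
  define \<alpha> where "\<alpha> = Arg z1"
  define \<delta> where "\<delta> = Arg (z2 * cis (- \<alpha>))"
  have z1: "z1 = rcis ?a \<alpha>" by (simp add: \<alpha>_def rcis_cmod_Arg)
  have "z2 * cis (- \<alpha>) = rcis ?b \<delta>"
    using rcis_cmod_Arg[of "z2 * cis (- \<alpha>)"] by (simp add: \<delta>_def norm_mult)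
  then have "z2 * cis (- \<alpha>) * cis \<alpha> = rcis ?b \<delta> * cis \<alpha>" by simp
  then have z2: "z2 = rcis ?b (\<alpha> + \<delta>)"
    by (simp add: rcis_def cis_mult mult.assoc add.commute)
  have "\<bar>\<delta>\<bar> \<le> pi" using Arg_bounded[of "z2 * cis (- \<alpha>)"] unfolding \<delta>_def by linarith
  then have angle: "?a * \<bar>\<delta>\<bar> \<le> 2 * ?d"
    using norm_mult_angle_le[of ?a ?b \<delta> \<alpha>] le by (simp flip: z1 z2)
  have "1 / (2 * pi) *
      (LBINT \<theta>=0..ereal (2 * pi). (LBINT t=0..1. cmod (Y k (sqrt t) \<theta> z1 - Y k (sqrt t) \<theta> z2)))
    \<le> ?a\<^sup>2 * \<bar>\<delta>\<bar> + (?b\<^sup>2 - ?a\<^sup>2)"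
    using outer_integral_le[OF assms(1) norm_ge_zero[of z1] le, of \<alpha> "\<alpha> + \<delta>"]
    by (simp add: field_simps flip: z1 z2)
  also have "\<dots> \<le> 2 * ?a * ?d + ?d * (?a + ?b)"
  proof (rule add_mono)
    show "?a\<^sup>2 * \<bar>\<delta>\<bar> \<le> 2 * ?a * ?d"
      using mult_left_mono[OF angle, of ?a] by (simp add: power2_eq_square algebra_simps)
    have "?b - ?a \<le> ?d" using norm_triangle_ineq2[of z2 z1] by (simp add: norm_minus_commute)
    then have "(?b - ?a) * (?a + ?b) \<le> ?d * (?a + ?b)" by (intro mult_right_mono) auto
    then show "?b\<^sup>2 - ?a\<^sup>2 \<le> ?d * (?a + ?b)" by (simp add: power2_eq_square algebra_simps)
  qed
  also have "\<dots> \<le> 2 * ?d * (?a + ?b)"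
    using mult_left_mono[OF le(1), of ?d] by (simp add: algebra_simps)
  finally show ?thesis .
qed

theorem lemma4p2:
  fixes k :: nat and z1 z2 :: complex
  assumes "k \<ge> 1"
    and "z1 \<in> cball 0 1" and "z2 \<in> cball 0 1"
  shows "1 / (2 * pi) *
      (LBINT \<theta>=0..ereal (2 * pi). (LBINT t=0..1. cmod (Y k (sqrt t) \<theta> z1 - Y k (sqrt t) \<theta> z2)))
    \<le> 2 * cmod (z1 - z2) * (cmod z1 + cmod z2)"
proof (cases "cmod z1 \<le> cmod z2")
  case True
  then show ?thesis using lemma4p2_ordered assms by simp
next
  case False
  then show ?thesis
    using lemma4p2_ordered[of k z2 z1] assms by (simp add: norm_minus_commute add.commute)
qed

end
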